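(* In the worst violated constraint model, there is an algorithm which, given oracle access to a hidden repetition-free 2SAT instance $\Phi$ on $n$ variables, generates a formula $\Phi'$ such that $\mathrm{SAT}(\Phi')=\mathrm{SAT}(\Phi)$, in time polynomial in $n$.
   Context: A SAT formula on Boolean variables $x_1,\dots,x_n$ is a conjunction of clauses $C_1,\dots,C_m$, each a disjunction of literals ($x_i$ or $\overline{x}_i$) on pairwise distinct variables; it is a 2SAT instance if each clause has at most $2$ literals. It is repetition-free if no two of its clauses are the same (i.e. no two clauses have the same set of literals). For a formula $\phi$, $\mathrm{SAT}(\phi)=\{\mathbf{x}\in\{0,1\}^n : \phi(\mathbf{x})=1\}$. Worst violated constraint model: the formula is hidden and is accessed only through an oracle. A query is a probabilistic assignment $\mathbf{a}:[n]\to[0,1]$, meaning that independently $\Pr[x_i=1]=\mathbf{a}(i)$ and $\Pr[\overline{x}_i=1]=1-\mathbf{a}(i)$. The violation probability of a clause $C_j$ with literal set $T(C_j)$ is $\Pr[C_j=0]=\prod_{\ell\in T(C_j)}\Pr[\ell=0]$. If all clauses have violation probability $0$, the oracle reports that the formula is satisfied; otherwise it returns the index $j$ of a clause with the highest violation probability, breaking ties arbitrarily (possibly adversarially). Running time is total running time, with each oracle query costing unit time. *)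

theory Defs
  imports Complex_Main "HOL-Library.FuncSet" "HOL-Computational_Algebra.Polynomial"
begin

section \<open>SAT formulas\<close>

datatype literal = Pos nat | Neg nat

fun var :: "literal \<Rightarrow> nat" where
  "var (Pos i) = i"
| "var (Neg i) = i"

fun lit_true :: "(nat \<Rightarrow> bool) \<Rightarrow> literal \<Rightarrow> bool" where
  "lit_true x (Pos i) \<longleftrightarrow> x i"
| "lit_true x (Neg i) \<longleftrightarrow> \<not> x i"

type_synonym clause = "literal set"

text \<open>A list, since the oracle refers to clauses by their index.\<close>
type_synonym formula = "clause list"

text \<open>The empty clause (identically false) is a clause.\<close>
definition is_clause :: "nat \<Rightarrow> clause \<Rightarrow> bool" where
  "is_clause n C \<longleftrightarrow> finite C \<and> var ` C \<subseteq> {1..n} \<and> inj_on var C"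

definition is_formula :: "nat \<Rightarrow> formula \<Rightarrow> bool" where
  "is_formula n \<Phi> \<longleftrightarrow> (\<forall>C\<in>set \<Phi>. is_clause n C)"

definition is_2sat :: "nat \<Rightarrow> formula \<Rightarrow> bool" where
  "is_2sat n \<Phi> \<longleftrightarrow> is_formula n \<Phi> \<and> (\<forall>C\<in>set \<Phi>. card C \<le> 2)"

definition repetition_free :: "formula \<Rightarrow> bool" where
  "repetition_free \<Phi> \<longleftrightarrow> distinct \<Phi>"

definition SAT :: "nat \<Rightarrow> formula \<Rightarrow> (nat \<Rightarrow> bool) set" where
  "SAT n \<Phi> = {x \<in> {1..n} \<rightarrow>\<^sub>E UNIV. \<forall>C\<in>set \<Phi>. \<exists>l\<in>C. lit_true x l}"


section \<open>The worst violated constraint oracle\<close>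

type_synonym query = "nat \<Rightarrow> real"

definition queries :: "nat \<Rightarrow> query set" where
  "queries n = {1..n} \<rightarrow>\<^sub>E {0..1}"

fun prob_false :: "query \<Rightarrow> literal \<Rightarrow> real" where
  "prob_false a (Pos i) = 1 - a i"
| "prob_false a (Neg i) = a i"

definition violation_prob :: "query \<Rightarrow> clause \<Rightarrow> real" where
  "violation_prob a C = (\<Prod>l\<in>C. prob_false a l)"

text \<open>\<open>None\<close> reports that the formula is satisfied; clause indices start at 1.\<close>
fun legal_answer :: "formula \<Rightarrow> query \<Rightarrow> nat option \<Rightarrow> bool" where
  "legal_answer \<Phi> a None \<longleftrightarrow> (\<forall>C\<in>set \<Phi>. violation_prob a C = 0)"
| "legal_answer \<Phi> a (Some j) \<longleftrightarrow>
     \<not> (\<forall>C\<in>set \<Phi>. violation_prob a C = 0) \<and>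
     j \<in> {1..length \<Phi>} \<and>
     (\<forall>C\<in>set \<Phi>. violation_prob a C \<le> violation_prob a (\<Phi> ! (j - 1)))"

text \<open>The first argument is the list of all earlier queries, so that an adversary may break
  ties adaptively, and differently when a query is repeated.\<close>
type_synonym clause_oracle = "query list \<Rightarrow> query \<Rightarrow> nat option"

definition worst_violated_oracle :: "nat \<Rightarrow> formula \<Rightarrow> clause_oracle \<Rightarrow> bool" where
  "worst_violated_oracle n \<Phi> orc \<longleftrightarrow>
     (\<forall>h. set h \<subseteq> queries n \<longrightarrow> (\<forall>a\<in>queries n. legal_answer \<Phi> a (orc h a)))"


section \<open>Oracle programs and their running time\<close>

text \<open>A random access machine with oracle, presented as a structured language. The memory
  consists of the arrays of naturals named in the program; a scalar is cell 0 of an array.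
  Every operation, memory access, test and output has unit cost. As addition and truncated
  subtraction are the only arithmetic, the bit length of stored numbers grows by at most one per
  arithmetic operation, so that the unit cost measure is polynomially related to Turing machine
  time.\<close>

datatype aexp =
    Const nat
  | Cell string aexp
  | Add aexp aexp
  | Sub aexp aexp

datatype bexp =
    Less aexp aexp
  | Equal aexp aexp
  | NotB bexp
  | AndB bexp bexp

datatype com =
    Skip
  | Store string aexp aexp
  | Output aexp
  | Query string string string
  | Seq com com
  | Cond bexp com com
  | While bexp com

type_synonym memory = "string \<Rightarrow> nat \<Rightarrow> nat"

fun aval :: "aexp \<Rightarrow> memory \<Rightarrow> nat" where
  "aval (Const k) m = k"
| "aval (Cell x e) m = m x (aval e m)"
| "aval (Add e e') m = aval e m + aval e' m"
| "aval (Sub e e') m = aval e m - aval e' m"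

fun acost :: "aexp \<Rightarrow> nat" where
  "acost (Const k) = 1"
| "acost (Cell x e) = 1 + acost e"
| "acost (Add e e') = 1 + acost e + acost e'"
| "acost (Sub e e') = 1 + acost e + acost e'"

fun bval :: "bexp \<Rightarrow> memory \<Rightarrow> bool" where
  "bval (Less e e') m \<longleftrightarrow> aval e m < aval e' m"
| "bval (Equal e e') m \<longleftrightarrow> aval e m = aval e' m"
| "bval (NotB b) m \<longleftrightarrow> \<not> bval b m"
| "bval (AndB b b') m \<longleftrightarrow> bval b m \<and> bval b' m"

fun bcost :: "bexp \<Rightarrow> nat" where
  "bcost (Less e e') = 1 + acost e + acost e'"
| "bcost (Equal e e') = 1 + acost e + acost e'"
| "bcost (NotB b) = 1 + bcost b"
| "bcost (AndB b b') = 1 + bcost b + bcost b'"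

record state =
  mem :: memory
  asked :: "query list"
  written :: "nat list"

definition store :: "string \<Rightarrow> nat \<Rightarrow> nat \<Rightarrow> memory \<Rightarrow> memory" where
  "store x i v m = m(x := (m x)(i := v))"

fun answer_code :: "nat option \<Rightarrow> nat" where
  "answer_code None = 0"
| "answer_code (Some j) = j"

text \<open>\<open>exec n orc c s t s'\<close>: with oracle \<open>orc\<close> for a formula on \<open>n\<close> variables, \<open>c\<close> started in
  \<open>s\<close> terminates in \<open>s'\<close> after time \<open>t\<close>. The command \<open>Query z p q\<close> asks for the probabilities
  \<open>p[i] / q[i]\<close>, \<open>1 \<le> i \<le> n\<close>, and stores the answer in \<open>z[0]\<close>; a program whose query is not a
  probabilistic assignment gets stuck.\<close>
inductive exec :: "nat \<Rightarrow> clause_oracle \<Rightarrow> com \<Rightarrow> state \<Rightarrow> nat \<Rightarrow> state \<Rightarrow> bool"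
  for n :: nat and orc :: clause_oracle where
  Skip: "exec n orc Skip s 1 s"
| Store: "exec n orc (Store x e e') s (1 + acost e + acost e')
     (s\<lparr>mem := store x (aval e (mem s)) (aval e' (mem s)) (mem s)\<rparr>)"
| Output: "exec n orc (Output e) s (1 + acost e)
     (s\<lparr>written := written s @ [aval e (mem s)]\<rparr>)"
| Query: "\<lbrakk>\<forall>i\<in>{1..n}. 0 < mem s q i \<and> mem s p i \<le> mem s q i;
     a = (\<lambda>i\<in>{1..n}. real (mem s p i) / real (mem s q i))\<rbrakk> \<Longrightarrow>
   exec n orc (Query z p q) s 1
     (s\<lparr>mem := store z 0 (answer_code (orc (asked s) a)) (mem s), asked := asked s @ [a]\<rparr>)"
| Seq: "\<lbrakk>exec n orc c s t s'; exec n orc c' s' t' s''\<rbrakk> \<Longrightarrow>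
   exec n orc (Seq c c') s (t + t') s''"
| CondTrue: "\<lbrakk>bval b (mem s); exec n orc c s t s'\<rbrakk> \<Longrightarrow>
   exec n orc (Cond b c c') s (1 + bcost b + t) s'"
| CondFalse: "\<lbrakk>\<not> bval b (mem s); exec n orc c' s t s'\<rbrakk> \<Longrightarrow>
   exec n orc (Cond b c c') s (1 + bcost b + t) s'"
| WhileFalse: "\<not> bval b (mem s) \<Longrightarrow> exec n orc (While b c) s (1 + bcost b) s"
| WhileTrue: "\<lbrakk>bval b (mem s); exec n orc c s t s'; exec n orc (While b c) s' t' s''\<rbrakk> \<Longrightarrow>
   exec n orc (While b c) s (1 + bcost b + t + t') s''"

inductive_cases exec_SkipE: "exec n orc Skip s t s'"
inductive_cases exec_StoreE: "exec n orc (Store x e e') s t s'"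
inductive_cases exec_OutputE: "exec n orc (Output e) s t s'"
inductive_cases exec_QueryE: "exec n orc (Query z p q) s t s'"
inductive_cases exec_SeqE: "exec n orc (Seq c c') s t s'"
inductive_cases exec_CondE: "exec n orc (Cond b c c') s t s'"
inductive_cases exec_WhileE: "exec n orc (While b c) s t s'"

text \<open>For a fixed oracle there is at most one run, so asserting that a run with given properties
  exists is asserting that the program terminates with these properties.\<close>
lemma exec_deterministic:
  "exec n orc c s t s' \<Longrightarrow> exec n orc c s u s'' \<Longrightarrow> u = t \<and> s'' = s'"
proof (induction arbitrary: u s'' rule: exec.induct)
  case (Seq c s t s' c' t' s2)
  from Seq.prems obtain t1 s1 t2 where
    "exec n orc c s t1 s1" "exec n orc c' s1 t2 s''" "u = t1 + t2"
    by (rule exec_SeqE) blast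
  with Seq.IH show ?case by metis
next
  case (CondTrue b s c t s' c')
  from CondTrue.prems CondTrue.hyps(1) obtain t1 where
    "exec n orc c s t1 s''" "u = 1 + bcost b + t1"
    by (elim exec_CondE) auto
  with CondTrue.IH show ?case by metis
next
  case (CondFalse b s c' t s' c)
  from CondFalse.prems CondFalse.hyps(1) obtain t1 where
    "exec n orc c' s t1 s''" "u = 1 + bcost b + t1"
    by (elim exec_CondE) auto
  with CondFalse.IH show ?case by metis
next
  case (WhileFalse b s c)
  from WhileFalse.prems show ?case
    by (rule exec_WhileE) (use WhileFalse.hyps in simp_all)
next
  case (WhileTrue b s c t s' t' s2)
  from WhileTrue.prems obtain t1 s1 t2 where
    "exec n orc c s t1 s1" "exec n orc (While b c) s1 t2 s''" "u = 1 + bcost b + t1 + t2"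
    by (rule exec_WhileE) (use WhileTrue.hyps(1) in auto)
  with WhileTrue.IH show ?case by metis
qed (auto elim: exec_SkipE exec_StoreE exec_OutputE exec_QueryE)

definition init_state :: "nat \<Rightarrow> state" where
  "init_state n = \<lparr>mem = store ''n'' 0 n (\<lambda>_ _. 0), asked = [], written = []\<rparr>"

fun lit_code :: "literal \<Rightarrow> nat" where
  "lit_code (Pos i) = 2 * i + 1"
| "lit_code (Neg i) = 2 * i + 2"

text \<open>A formula is written clause by clause, literal by literal, each clause ending with 0.\<close>
definition encodes :: "nat list \<Rightarrow> formula \<Rightarrow> bool" where
  "encodes w \<Phi> \<longleftrightarrow> (\<exists>Cs. (\<forall>C\<in>set Cs. distinct C) \<and> map set Cs = \<Phi> \<and>
     w = concat (map (\<lambda>C. map lit_code C @ [0]) Cs))"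

end

theory Submission
  imports Defs
begin

text \<open>Every candidate clause \<open>S\<close> with at most two literals is tested on its own. Query the
  assignment that falsifies \<open>S\<close> and gives every other variable probability 1/2, and let \<open>j\<close> be
  the answer. If \<open>S\<close> is a clause of the formula and no proper subset of it is, then \<open>S\<close> is the only
  clause violated with probability 1; as the formula is repetition-free, the answer stays \<open>j\<close> when
  one other variable is moved to 7/8 or 1/8, and some clause remains violated when it is moved to 1
  or 0. Conversely, a test with this outcome implies that some clause of the formula is contained
  in \<open>S\<close>. Hence the candidates that pass are implied by the formula and include all its
  inclusion-minimal clauses.\<close>

section \<open>Testing a candidate clause\<close>

lemma prob_false_nonneg: "a \<in> queries n \<Longrightarrow> var l \<in> {1..n} \<Longrightarrow> 0 \<le> prob_false a l"
  and prob_false_le_1: "a \<in> queries n \<Longrightarrow> var l \<in> {1..n} \<Longrightarrow> prob_false a l \<le> 1"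
  by (cases l; force simp: queries_def PiE_iff)+

lemma violation_prob_le_prob_false:
  assumes "a \<in> queries n" "is_clause n C" "l \<in> C"
  shows "violation_prob a C \<le> prob_false a l"
proof -
  have fin: "finite C" and range: "\<And>l. l \<in> C \<Longrightarrow> var l \<in> {1..n}"
    using assms(2) by (auto simp: is_clause_def)
  have "violation_prob a C = prob_false a l * (\<Prod>k\<in>C - {l}. prob_false a k)"
    unfolding violation_prob_def using fin assms(3) by (simp add: prod.remove)
  also have "\<dots> \<le> prob_false a l * 1"
    by (intro mult_left_mono prod_le_1 conjI prob_false_nonneg[OF assms(1)] prob_false_le_1[OF assms(1)])
      (use range assms(3) in auto)
  finally show ?thesis by simp
qed

text \<open>Since \<open>e \<le> 1\<close>, having fewer than two factors only enlarges the product;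
  the clause size bound enters the test here. For \<open>e = 1/2\<close> it gives 1/4, which will be
  played against an upper bound of 1/8.\<close>

lemma violation_prob_ge:
  assumes "is_clause n C" "card C \<le> 2" "\<And>l. l \<in> C \<Longrightarrow> e \<le> prob_false a l" "0 \<le> e" "e \<le> 1"
  shows "e\<^sup>2 \<le> violation_prob a C"
proof -
  have "e\<^sup>2 \<le> e ^ card C"
    using assms(2,4,5) by (intro power_decreasing)
  also have "\<dots> = (\<Prod>l\<in>C. e)" by simp
  also have "\<dots> \<le> violation_prob a C"
    unfolding violation_prob_def using assms(3,4) by (intro prod_mono) auto
  finally show ?thesis .
qed

lemma literal_same_var: "var k = var l \<Longrightarrow> k \<noteq> l \<Longrightarrow> prob_false a k = 1 - prob_false a l"
  by (cases k; cases l) auto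

section \<open>Soundness and completeness of the test of one candidate clause\<close>

locale hidden_2sat =
  fixes n :: nat and \<Phi> :: formula and orc :: clause_oracle
  assumes two_sat: "is_2sat n \<Phi>" and rep_free: "repetition_free \<Phi>"
    and worst_violated: "worst_violated_oracle n \<Phi> orc"
begin

lemma clause: "C \<in> set \<Phi> \<Longrightarrow> is_clause n C" and card_clause: "C \<in> set \<Phi> \<Longrightarrow> card C \<le> 2"
  using two_sat by (auto simp: is_2sat_def is_formula_def)

text \<open>The perturbation at \<open>r\<close> acts only outside \<open>S\<close>: taking
  \<open>r = 0\<close>, which is no variable, or an \<open>r\<close> occurring in \<open>S\<close>
  gives the unperturbed query.\<close>

definition refutes :: "query \<Rightarrow> clause \<Rightarrow> nat \<Rightarrow> real \<Rightarrow> bool" where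
  "refutes a S r v \<longleftrightarrow> a \<in> queries n \<and> (\<forall>l\<in>S. prob_false a l = 1) \<and>
     (\<forall>x\<in>{1..n} - var ` S. a x = (if x = r then v else 1 / 2))"

lemma refutes_outside:
  "refutes a S r v \<Longrightarrow> x \<in> {1..n} \<Longrightarrow> x \<notin> var ` S \<Longrightarrow> a x = (if x = r then v else 1 / 2)"
  unfolding refutes_def by blast

lemma refutes_neg:
  assumes "refutes a S r v" "k \<in> S" "var l = var k" "l \<noteq> k"
  shows "prob_false a l = 0"
  using literal_same_var[OF assms(3,4), of a] assms(1,2) by (simp add: refutes_def)

text \<open>Remembering only that \<open>z\<close> encodes some legal answer to some refuting query
  hides the query history, so adaptive tie breaking needs no separate treatment.\<close>

definition answers :: "clause \<Rightarrow> nat \<Rightarrow> real \<Rightarrow> nat \<Rightarrow> bool" where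
  "answers S r v z \<longleftrightarrow> (\<exists>a x. refutes a S r v \<and> legal_answer \<Phi> a x \<and> z = answer_code x)"

definition minimal :: "clause \<Rightarrow> bool" where
  "minimal S \<longleftrightarrow> S \<in> set \<Phi> \<and> (\<forall>D\<in>set \<Phi>. D \<subseteq> S \<longrightarrow> D = S)"

text \<open>At 7/8 or 1/8 one literal of \<open>r\<close> is false with probability 1/8, less than
  the 1/4 of two free literals at 1/2; at 1 or 0 it is certainly true. The inner values must
  reproduce the index \<open>j\<close>, the extreme ones must only avoid the report of
  satisfaction.\<close>

definition passes :: "clause \<Rightarrow> nat \<Rightarrow> nat \<Rightarrow> bool" where
  "passes S j r \<longleftrightarrow> answers S r (7 / 8) j \<and> (\<exists>z>0. answers S r 1 z) \<and>
     answers S r (1 / 8) j \<and> (\<exists>z>0. answers S r 0 z)"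

text \<open>\<open>S\<close> itself is violated with probability 1 whatever \<open>v\<close> is, so
  satisfaction (code 0) cannot be reported.\<close>

lemma answers_member_pos:
  assumes "S \<in> set \<Phi>" "answers S r v z"
  shows "z > 0"
proof -
  obtain a x where a: "refutes a S r v" "legal_answer \<Phi> a x" "z = answer_code x"
    using assms(2) by (auto simp: answers_def)
  have "violation_prob a S = 1"
    using a(1) by (auto simp: violation_prob_def refutes_def intro: prod.neutral)
  then show ?thesis using a assms(1) by (cases x) auto
qed

text \<open>By minimality any other clause has a literal outside \<open>S\<close>. It is either
  opposite to a literal of \<open>S\<close>, hence certainly true, or free with falsity probability
  below 1 because \<open>v\<close> is strictly between 0 and 1. So only \<open>S\<close> reaches
  violation probability 1.\<close>

lemma refuting_answer_minimal:
  assumes S: "minimal S" and v: "0 < v" "v < 1" and a: "refutes a S r v" "legal_answer \<Phi> a x"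
  obtains j where "x = Some (Suc j)" "j < length \<Phi>" "\<Phi> ! j = S"
proof -
  have vS: "violation_prob a S = 1"
    using a(1) by (auto simp: violation_prob_def refutes_def intro: prod.neutral)
  have SP: "S \<in> set \<Phi>" using S by (simp add: minimal_def)
  obtain i where x: "x = Some i" using a SP vS by (cases x) auto
  then obtain j where j: "i = Suc j" "j < length \<Phi>" and max: "violation_prob a S \<le> violation_prob a (\<Phi> ! j)"
    using a SP by (cases i) auto
  have eq: "\<Phi> ! j = S"
  proof (rule ccontr)
    assume "\<Phi> ! j \<noteq> S"
    moreover have mem: "\<Phi> ! j \<in> set \<Phi>" using j by simp
    ultimately obtain l where l: "l \<in> \<Phi> ! j" "l \<notin> S" using S by (auto simp: minimal_def)
    have range: "var l \<in> {1..n}" using clause[OF mem] l by (auto simp: is_clause_def)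
    have "prob_false a l < 1"
    proof (cases "var l \<in> var ` S")
      case True
      then obtain k where "k \<in> S" "var k = var l" by auto
      then show ?thesis
        using refutes_neg[OF a(1), of k l] l(2) by fastforce
    next
      case False
      then have "a (var l) = (if var l = r then v else 1/2)" using refutes_outside[OF a(1) range] by simp
      then show ?thesis using v by (cases l) (auto split: if_splits)
    qed
    moreover have "violation_prob a (\<Phi> ! j) \<le> prob_false a l"
      using violation_prob_le_prob_false[OF _ clause[OF mem] l(1)] a(1) by (simp add: refutes_def)
    ultimately have "violation_prob a (\<Phi> ! j) < 1" by (rule order_le_less_trans[rotated])
    then show False using max vS by simp
  qed
  show thesis using x j eq by (intro that) simp_all
qed

text \<open>Both answers are indices of \<open>S\<close>, and repetition-freeness leaves only one
  such index.\<close>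

lemma answers_minimal_eq:
  assumes S: "minimal S" and v: "0 < v" "v < 1" "answers S r v z" and v': "0 < v'" "v' < 1" "answers S r' v' z'"
  shows "z = z'"
proof -
  obtain a x where a: "refutes a S r v" "legal_answer \<Phi> a x" "z = answer_code x"
    using v(3) by (auto simp: answers_def)
  obtain a' x' where a': "refutes a' S r' v'" "legal_answer \<Phi> a' x'" "z' = answer_code x'"
    using v'(3) by (auto simp: answers_def)
  obtain j where j: "x = Some (Suc j)" "j < length \<Phi>" "\<Phi> ! j = S"
    using refuting_answer_minimal[OF S v(1,2) a(1,2)] .
  obtain j' where j': "x' = Some (Suc j')" "j' < length \<Phi>" "\<Phi> ! j' = S"
    using refuting_answer_minimal[OF S v'(1,2) a'(1,2)] .
  have "j = j'" using rep_free j j' by (metis repetition_free_def nth_eq_iff_index_eq)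
  then show ?thesis using a a' j j' by simp
qed

text \<open>If the worst clause under the unperturbed query contains a literal \<open>e\<close> outside \<open>S\<close> and is
  still the worst one when \<open>e\<close> is likely true, then every clause is satisfied by \<open>e\<close> or by
  falsifying \<open>S\<close>, so that making \<open>e\<close> certainly true satisfies the formula.\<close>
lemma passes_imp_subclause:
  assumes base: "answers S 0 v j" "j > 0" and pass: "\<And>r. r \<le> n \<Longrightarrow> passes S j r"
  shows "\<exists>D\<in>set \<Phi>. D \<subseteq> S"
proof (rule ccontr)
  assume "\<not> ?thesis"
  then have no: "\<not> D \<subseteq> S" if "D \<in> set \<Phi>" for D using that by blast
  obtain a x where a: "refutes a S 0 v" "legal_answer \<Phi> a x" "j = answer_code x"
    using base(1) by (auto simp: answers_def)
  have ans: "legal_answer \<Phi> a (Some j)" using a base(2) by (cases x) auto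
  define C where "C = \<Phi> ! (j - 1)"
  have C: "C \<in> set \<Phi>" and pos: "violation_prob a C \<noteq> 0"
  proof -
    show "C \<in> set \<Phi>" using ans unfolding C_def by auto
    obtain D where "D \<in> set \<Phi>" "violation_prob a D \<noteq> 0" "violation_prob a D \<le> violation_prob a C"
      using ans unfolding C_def by auto
    moreover have "0 \<le> violation_prob a D"
      unfolding violation_prob_def using clause[OF \<open>D \<in> set \<Phi>\<close>] a(1)
      by (intro prod_nonneg prob_false_nonneg) (auto simp: is_clause_def refutes_def)
    ultimately show "violation_prob a C \<noteq> 0" by linarith
  qed
  obtain e where e: "e \<in> C" "e \<notin> S" using no[OF C] by blast
  have range: "var e \<in> {1..n}" using clause[OF C] e by (auto simp: is_clause_def)
  \<comment> \<open>Otherwise \<open>e\<close> would be opposite to a literal of \<open>S\<close>,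
    hence certainly true, and \<open>C\<close> would not be violated at all.\<close>
  have outside: "var e \<notin> var ` S"
  proof
    assume "var e \<in> var ` S"
    then obtain k where "k \<in> S" "var k = var e" by auto
    then have "prob_false a e = 0"
      using refutes_neg[OF a(1), of k e] e(2) by fastforce
    then show False
      using pos e clause[OF C] by (auto simp: violation_prob_def is_clause_def intro: prod_zero)
  qed
  \<comment> \<open>The perturbation goes in the direction that favours \<open>e\<close>: upwards
    for a positive literal, downwards for a negative one. Thus \<open>e\<close> is false with
    probability 1/8 at \<open>u\<close> and 0 at \<open>w\<close>.\<close>
  have "\<exists>u w. answers S (var e) u j \<and> (\<exists>z>0. answers S (var e) w z) \<and>
      (u = 7/8 \<and> w = 1 \<and> e = Pos (var e) \<or> u = 1/8 \<and> w = 0 \<and> e = Neg (var e))"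
    using pass[of "var e"] range unfolding passes_def by (cases e) auto
  then obtain u w z where uw: "answers S (var e) u j" "z > 0" "answers S (var e) w z"
      "u = 7/8 \<and> w = 1 \<and> e = Pos (var e) \<or> u = 1/8 \<and> w = 0 \<and> e = Neg (var e)"
    by blast
  obtain b y where b: "refutes b S (var e) u" "legal_answer \<Phi> b y" "j = answer_code y"
    using uw(1) by (auto simp: answers_def)
  have ans': "legal_answer \<Phi> b (Some j)" using b base(2) by (cases y) auto
  have "b (var e) = u" using refutes_outside[OF b(1) range outside] by simp
  then have bo: "prob_false b e = 1/8" using uw(4) by (cases e) auto
  \<comment> \<open>The answer \<open>j\<close> still names \<open>C\<close>, which contains
    \<open>e\<close>, so even the worst clause is violated with probability at most 1/8.\<close>
  have small: "violation_prob b D \<le> 1/8" if "D \<in> set \<Phi>" for D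
  proof -
    have "violation_prob b D \<le> violation_prob b C" using ans' that unfolding C_def by auto
    also have "\<dots> \<le> prob_false b e"
      using violation_prob_le_prob_false[OF _ clause[OF C] e(1)] b(1) by (simp add: refutes_def)
    finally show ?thesis using bo by simp
  qed
  have sat: "e \<in> D \<or> (\<exists>l\<in>D. \<exists>k\<in>S. var l = var k \<and> l \<noteq> k)" if D: "D \<in> set \<Phi>" for D
  proof (rule ccontr)
    assume contr: "\<not> ?thesis"
    \<comment> \<open>Every literal of such a \<open>D\<close> lies in \<open>S\<close> (falsity 1),
      is opposite to \<open>e\<close> (7/8) or is free (1/2), so \<open>D\<close> would reach 1/4 >
      1/8.\<close>
    have "(1/2)\<^sup>2 \<le> violation_prob b D"
    proof (rule violation_prob_ge[OF clause[OF D] card_clause[OF D]])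
      fix l assume l: "l \<in> D"
      have lr: "var l \<in> {1..n}" using clause[OF D] l by (auto simp: is_clause_def)
      show "1/2 \<le> prob_false b l"
      proof (cases "var l \<in> var ` S")
        case True
        then have "l \<in> S" using contr l by force
        then show ?thesis using b(1) by (simp add: refutes_def)
      next
        case False
        show ?thesis
        proof (cases "var l = var e")
          case True
          then have "prob_false b l = 1 - prob_false b e"
            using literal_same_var[of l e b] contr l by metis
          then show ?thesis using bo by simp
        next
          case ne: False
          have "b (var l) = 1/2" using refutes_outside[OF b(1) lr False] ne by simp
          then show ?thesis by (cases l) auto
        qed
      qed
    qed auto
    then show False using small[OF D] by (simp add: power2_eq_square)
  qed
  obtain c y' where c: "refutes c S (var e) w" "legal_answer \<Phi> c y'" "z = answer_code y'"
    using uw(3) by (auto simp: answers_def)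
  have "c (var e) = w" using refutes_outside[OF c(1) range outside] by simp
  then have co: "prob_false c e = 0" using uw(4) by (cases e) auto
  have "violation_prob c D = 0" if D: "D \<in> set \<Phi>" for D
  proof -
    have "\<exists>l\<in>D. prob_false c l = 0"
      using sat[OF D]
    proof (elim disjE bexE conjE)
      fix l k assume "l \<in> D" "k \<in> S" "var l = var k" "l \<noteq> k"
      then show ?thesis using refutes_neg[OF c(1)] by blast
    qed (use co in auto)
    then show ?thesis using clause[OF D] by (auto simp: violation_prob_def is_clause_def intro: prod_zero)
  qed
  then show False using c uw(2) by (cases y') auto
qed

lemma legal: "set h \<subseteq> queries n \<Longrightarrow> a \<in> queries n \<Longrightarrow> legal_answer \<Phi> a (orc h a)"
  using worst_violated by (auto simp: worst_violated_oracle_def)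

lemma obtain_minimal:
  assumes "D \<in> set \<Phi>"
  obtains S where "minimal S" "S \<subseteq> D"
proof -
  have "\<exists>S. minimal S \<and> S \<subseteq> D"
    using assms
  proof (induction "card D" arbitrary: D rule: less_induct)
    case less
    show ?case
    proof (cases "minimal D")
      case False
      then obtain D' where D': "D' \<in> set \<Phi>" "D' \<subset> D" using less.prems by (auto simp: minimal_def)
      then have "card D' < card D"
        using clause[OF less.prems] by (auto simp: is_clause_def intro: psubset_card_mono)
      then show ?thesis using less.hyps D' by blast
    qed auto
  qed
  then show thesis using that by blast
qed

end

section \<open>Reasoning about programs and their running time\<close>

text \<open>A total-correctness precondition whose postcondition also receives the running time, so
  that correctness and cost come from the same symbolic execution.\<close>

definition wp :: "nat \<Rightarrow> clause_oracle \<Rightarrow> com \<Rightarrow> (nat \<Rightarrow> state \<Rightarrow> bool) \<Rightarrow> state \<Rightarrow> bool" where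
  "wp n orc c Q s \<longleftrightarrow> (\<exists>t s'. exec n orc c s t s' \<and> Q t s')"

lemma wp_mono: "wp n orc c P s \<Longrightarrow> (\<And>t s'. P t s' \<Longrightarrow> Q t s') \<Longrightarrow> wp n orc c Q s"
  unfolding wp_def by blast

lemma wp_Skip [simp]: "wp n orc Skip Q s \<longleftrightarrow> Q 1 s"
  unfolding wp_def by (metis exec.Skip exec_SkipE)

lemma wp_Store [simp]: "wp n orc (Store x e e') Q s \<longleftrightarrow>
    Q (1 + acost e + acost e') (s\<lparr>mem := store x (aval e (mem s)) (aval e' (mem s)) (mem s)\<rparr>)"
  unfolding wp_def by (metis exec.Store exec_StoreE)

lemma wp_Output [simp]: "wp n orc (Output e) Q s \<longleftrightarrow>
    Q (1 + acost e) (s\<lparr>written := written s @ [aval e (mem s)]\<rparr>)"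
  unfolding wp_def by (metis exec.Output exec_OutputE)

lemma wp_Query:
  assumes "\<forall>i\<in>{1..n}. 0 < mem s q i \<and> mem s p i \<le> mem s q i"
    and "a = (\<lambda>i\<in>{1..n}. real (mem s p i) / real (mem s q i))"
    and "Q 1 (s\<lparr>mem := store z 0 (answer_code (orc (asked s) a)) (mem s), asked := asked s @ [a]\<rparr>)"
  shows "wp n orc (Query z p q) Q s"
  unfolding wp_def using exec.Query[OF assms(1,2)] assms(3) by blast

lemma wp_Seq [simp]: "wp n orc (Seq c c') Q s \<longleftrightarrow> wp n orc c (\<lambda>t. wp n orc c' (\<lambda>t'. Q (t + t'))) s"
  unfolding wp_def by (blast elim: exec_SeqE intro: exec.Seq)

lemma wp_Cond [simp]: "wp n orc (Cond b c c') Q s \<longleftrightarrow>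
    (if bval b (mem s) then wp n orc c (\<lambda>t. Q (1 + bcost b + t)) s
     else wp n orc c' (\<lambda>t. Q (1 + bcost b + t)) s)"
proof (cases "bval b (mem s)")
  case True
  then have "exec n orc (Cond b c c') s t s' \<longleftrightarrow> (\<exists>u. t = 1 + bcost b + u \<and> exec n orc c s u s')" for t s'
    by (auto elim: exec_CondE dest: exec.CondTrue[where c' = c'])
  with True show ?thesis unfolding wp_def by auto
next
  case False
  then have "exec n orc (Cond b c c') s t s' \<longleftrightarrow> (\<exists>u. t = 1 + bcost b + u \<and> exec n orc c' s u s')" for t s'
    by (auto elim: exec_CondE dest: exec.CondFalse[where c = c])
  with False show ?thesis unfolding wp_def by auto
qed

text \<open>For loops whose number \<open>N\<close> of rounds is known: \<open>I\<close> is indexed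
  by the rounds completed, each round pays for one guard and one body, and the last summand pays for
  the failing guard.\<close>

lemma wp_While_count:
  assumes step: "\<And>x s. x < N \<Longrightarrow> I x s \<Longrightarrow>
      bval b (mem s) \<and> wp n orc c (\<lambda>t s'. t \<le> T \<and> I (Suc x) s') s"
    and final: "\<And>s. I N s \<Longrightarrow> \<not> bval b (mem s)"
    and init: "I 0 s"
  shows "wp n orc (While b c) (\<lambda>t s'. t \<le> N * (1 + bcost b + T) + (1 + bcost b) \<and> I N s') s"
proof -
  have "wp n orc (While b c) (\<lambda>t s'. t \<le> (N - x) * (1 + bcost b + T) + (1 + bcost b) \<and> I N s') s"
    if "x \<le> N" "I x s" for x s
    using that
  proof (induction "N - x" arbitrary: x s)
    case 0
    then have "x = N" by simp
    with 0 final show ?case unfolding wp_def by (fastforce intro: exec.WhileFalse)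
  next
    case (Suc d)
    then have "x < N" by simp
    with step Suc.prems obtain t s' where b: "bval b (mem s)"
      and c: "exec n orc c s t s'" "t \<le> T" "I (Suc x) s'"
      unfolding wp_def by blast
    obtain t' s'' where w: "exec n orc (While b c) s' t' s''"
        "t' \<le> (N - Suc x) * (1 + bcost b + T) + (1 + bcost b)" "I N s''"
      using Suc.hyps(1)[of "Suc x" s', unfolded wp_def] Suc.hyps(2) \<open>x < N\<close> c(3) by fastforce
    have "N - x = Suc (N - Suc x)" using \<open>x < N\<close> by simp
    then have "1 + bcost b + t + t' \<le> (N - x) * (1 + bcost b + T) + (1 + bcost b)"
      using w(2) c(2) by simp
    with exec.WhileTrue[OF b c(1) w(1)] w(3) show ?case unfolding wp_def by blast
  qed
  from this[of 0 s] init show ?thesis by simp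
qed


section \<open>The learning program\<close>

text \<open>Variable 0 does not exist and plays the role of a missing literal: cell 0 of the
  probability arrays is ignored by queries.\<close>

definition lit :: "bool \<Rightarrow> nat \<Rightarrow> literal" where
  "lit neg i = (if neg then Neg i else Pos i)"

definition cand :: "bool \<Rightarrow> bool \<Rightarrow> nat \<Rightarrow> nat \<Rightarrow> literal list" where
  "cand b c i k = (if i \<noteq> 0 \<and> i \<noteq> k then [lit b i] else []) @ (if k \<noteq> 0 then [lit c k] else [])"

abbreviation V :: "string \<Rightarrow> aexp" where
  "V x \<equiv> Cell x (Const 0)"

text \<open>A numerator over the common denominator 8, which makes 0, 1/8, 1/2, 7/8 and 1 all
  expressible.\<close>

definition falsify :: "bool \<Rightarrow> nat" where
  "falsify neg = (if neg then 8 else 0)"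

text \<open>The order of the stores matters: the candidate is written after \<open>r\<close>, so it
  overrides a perturbation of its own variables, and for \<open>i = k\<close> the last store wins,
  matching the literal kept by \<open>cand\<close>. Afterwards all touched cells return to
  4/8.\<close>

definition ask :: "bool \<Rightarrow> bool \<Rightarrow> nat \<Rightarrow> com" where
  "ask b c v =
     Seq (Store ''p'' (V ''r'') (Const v))
    (Seq (Store ''p'' (V ''i'') (Const (falsify b)))
    (Seq (Store ''p'' (V ''k'') (Const (falsify c)))
    (Seq (Query ''z'' ''p'' ''q'')
    (Seq (Store ''p'' (V ''r'') (Const 4))
    (Seq (Store ''p'' (V ''i'') (Const 4))
         (Store ''p'' (V ''k'') (Const 4)))))))"

text \<open>The flag \<open>f\<close> is only ever raised here, so it accumulates failures over
  successive probes.\<close>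

definition probe :: "bool \<Rightarrow> bool \<Rightarrow> nat \<Rightarrow> bexp \<Rightarrow> com" where
  "probe b c v g = Seq (ask b c v) (Cond g Skip (Store ''f'' (Const 0) (Const 1)))"

definition same :: bexp where "same = Equal (V ''z'') (V ''j'')"

definition nonzero :: bexp where "nonzero = Less (Const 0) (V ''z'')"

definition incr :: "string \<Rightarrow> com" where
  "incr x = Store x (Const 0) (Add (V x) (Const 1))"

definition up_to_n :: "string \<Rightarrow> bexp" where
  "up_to_n x = Less (V x) (Add (V ''n'') (Const 1))"

definition probes :: "bool \<Rightarrow> bool \<Rightarrow> com" where
  "probes b c =
     Seq (probe b c 7 same) (Seq (probe b c 8 nonzero)
    (Seq (probe b c 1 same) (Seq (probe b c 0 nonzero) (incr ''r''))))"

definition emit_lit :: "bool \<Rightarrow> string \<Rightarrow> com" where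
  "emit_lit neg x = Output (Add (Add (V x) (V x)) (Const (if neg then 2 else 1)))"

definition emit :: "bool \<Rightarrow> bool \<Rightarrow> com" where
  "emit b c = Cond (Equal (V ''f'') (Const 0))
     (Seq (Cond (AndB (NotB (Equal (V ''i'') (Const 0))) (NotB (Equal (V ''i'') (V ''k''))))
            (emit_lit b ''i'') Skip)
     (Seq (Cond (NotB (Equal (V ''k'') (Const 0))) (emit_lit c ''k'') Skip)
          (Output (Const 0))))
     Skip"

text \<open>With \<open>r = 0\<close> the first query is unperturbed and its answer is the reference
  index \<open>j\<close>; \<open>j = 0\<close> means satisfied and rejects the candidate at
  once.\<close>

definition task :: "bool \<Rightarrow> bool \<Rightarrow> com" where
  "task b c =
     Seq (Store ''r'' (Const 0) (Const 0))
    (Seq (ask b c 4)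
    (Seq (Store ''j'' (Const 0) (V ''z''))
    (Seq (Cond (Equal (V ''j'') (Const 0)) (Store ''f'' (Const 0) (Const 1)) (Store ''f'' (Const 0) (Const 0)))
    (Seq (While (up_to_n ''r'') (probes b c)) (emit b c)))))"

definition tasks :: com where
  "tasks = Seq (task False False) (Seq (task False True) (Seq (task True False)
     (Seq (task True True) (incr ''k''))))"

definition row :: com where
  "row = Seq (Store ''k'' (Const 0) (Const 0)) (Seq (While (up_to_n ''k'') tasks) (incr ''i''))"

definition setup_cell :: com where
  "setup_cell = Seq (Store ''p'' (V ''r'') (Const 4)) (Seq (Store ''q'' (V ''r'') (Const 8)) (incr ''r''))"

text \<open>Both loops rely on the zero-initialised memory for the start values of \<open>r\<close>
  and \<open>i\<close>.\<close>

definition learner :: com where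
  "learner = Seq (While (up_to_n ''r'') setup_cell) (While (up_to_n ''i'') row)"

lemma bval_up_to_n [simp]: "bval (up_to_n x) m \<longleftrightarrow> m x 0 < Suc (m ''n'' 0)"
  and bcost_up_to_n [simp]: "bcost (up_to_n x) = 7"
  by (simp_all add: up_to_n_def)

section \<open>Program invariants and the representation of clauses by candidates\<close>

context hidden_2sat
begin

text \<open>The history is tracked because the oracle is legal only after earlier queries in
  \<open>queries n\<close>.\<close>

definition ready :: "state \<Rightarrow> bool" where
  "ready s \<longleftrightarrow> mem s ''n'' 0 = n \<and> (\<forall>x\<in>{1..n}. mem s ''p'' x = 4 \<and> mem s ''q'' x = 8) \<and>
     set (asked s) \<subseteq> queries n"

text \<open>Soundness and completeness of the output: each written clause is implied by a clause it
  contains, and no minimal clause among the candidates \<open>A\<close> treated so far is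
  missing.\<close>

definition learned :: "clause set \<Rightarrow> nat list \<Rightarrow> bool" where
  "learned A w \<longleftrightarrow> (\<exists>Cs. (\<forall>C\<in>set Cs. distinct C \<and> is_clause n (set C) \<and> (\<exists>D\<in>set \<Phi>. D \<subseteq> set C)) \<and>
     w = concat (map (\<lambda>C. map lit_code C @ [0]) Cs) \<and>
     (\<forall>S\<in>A. minimal S \<longrightarrow> S \<in> set ` set Cs))"

lemma refutes_query:
  assumes "i \<le> n" "k \<le> n" "v \<le> 8" "\<forall>x\<in>{1..n}. P x = 4 \<and> Q x = 8"
  shows "refutes (\<lambda>x\<in>{1..n}. real ((P(r := v, i := falsify b, k := falsify c)) x) / real (Q x))
    (set (cand b c i k)) r (real v / 8)"
  unfolding refutes_def
proof (intro conjI ballI)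
  show "(\<lambda>x\<in>{1..n}. real ((P(r := v, i := falsify b, k := falsify c)) x) / real (Q x)) \<in> queries n"
    using assms(3,4) by (auto simp: queries_def falsify_def)
qed (use assms in \<open>auto simp: cand_def lit_def falsify_def split: if_splits\<close>)

lemma is_clause_cand: "i \<le> n \<Longrightarrow> k \<le> n \<Longrightarrow> is_clause n (set (cand b c i k))"
  and distinct_cand: "distinct (cand b c i k)"
  by (auto simp: is_clause_def cand_def lit_def inj_on_def)

text \<open>Index 0 fills in for missing literals. A two-literal clause has distinct variables, so
  the case \<open>i = k\<close>, where \<open>cand\<close> drops a literal, does not arise for
  it.\<close>

lemma clause_eq_cand:
  assumes "is_clause n C" "card C \<le> 2"
  obtains b c i k where "i \<le> n" "k \<le> n" "C = set (cand b c i k)"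
proof -
  have l: "\<exists>b. l = lit b (var l)" for l by (cases l) (auto simp: lit_def)
  have fin: "finite C" using assms by (simp add: is_clause_def)
  consider "card C = 0" | "card C = 1" | "card C = 2" using assms(2) by linarith
  then show thesis
  proof cases
    case 1
    then show thesis using fin that[of 0 0 True True] by (simp add: cand_def)
  next
    case 2
    then obtain l where C: "C = {l}" by (auto simp: card_1_singleton_iff)
    obtain b where "l = lit b (var l)" using l by blast
    then show thesis using C assms(1) that[of 0 "var l" True b] by (auto simp: cand_def is_clause_def)
  next
    case 3
    then obtain l m where C: "C = {l, m}" "l \<noteq> m" by (auto simp: card_2_iff)
    obtain b c where "l = lit b (var l)" "m = lit c (var m)" using l by meson
    moreover have "var l \<noteq> var m" using C assms(1) by (auto simp: is_clause_def)
    ultimately show thesis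
      using C assms(1) that[of "var l" "var m" b c] by (auto simp: cand_def is_clause_def)
  qed
qed

section \<open>Querying, probing and deciding one candidate\<close>

lemma wp_ask:
  assumes "ready s" "mem s ''i'' 0 \<le> n" "mem s ''k'' 0 \<le> n" "v \<le> 8"
  shows "wp n orc (ask b c v) (\<lambda>t s'. t = 25 \<and> ready s' \<and> written s' = written s \<and>
     (\<forall>x. x \<noteq> ''p'' \<longrightarrow> x \<noteq> ''z'' \<longrightarrow> mem s' x = mem s x) \<and>
     answers (set (cand b c (mem s ''i'' 0) (mem s ''k'' 0))) (mem s ''r'' 0) (real v / 8) (mem s' ''z'' 0)) s"
proof -
  define i k r where ikr: "i = mem s ''i'' 0" "k = mem s ''k'' 0" "r = mem s ''r'' 0"
  define P where "P = (mem s ''p'')(r := v, i := falsify b, k := falsify c)"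
  define a where "a = (\<lambda>x\<in>{1..n}. real (P x) / real (mem s ''q'' x))"
  have ref: "refutes a (set (cand b c i k)) r (real v / 8)"
    unfolding a_def P_def using assms by (intro refutes_query) (auto simp: ikr ready_def)
  have a: "a \<in> queries n" using ref by (simp add: refutes_def)
  have legal: "legal_answer \<Phi> a (orc (asked s) a)"
    using assms(1) a by (intro legal) (auto simp: ready_def)
  have P: "\<forall>x\<in>{1..n}. 0 < mem s ''q'' x \<and> P x \<le> mem s ''q'' x"
    using assms by (auto simp: P_def ready_def falsify_def)
  \<comment> \<open>The time 25 is six stores of cost 4 plus one query.\<close>
  show ?thesis
    unfolding ask_def
    apply (simp add: store_def flip: ikr)
    apply (rule wp_Query[where a = a])
    subgoal using P by (simp add: P_def)
    subgoal by (simp add: a_def P_def)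
    subgoal using assms(1) a ref legal
      by (auto simp: store_def ready_def answers_def simp flip: ikr)
    done
qed

definition frame :: "string set \<Rightarrow> state \<Rightarrow> state \<Rightarrow> bool" where
  "frame X s s' \<longleftrightarrow> ready s' \<and> written s' = written s \<and> (\<forall>x. x \<notin> X \<longrightarrow> mem s' x = mem s x)"

abbreviation cur :: "bool \<Rightarrow> bool \<Rightarrow> state \<Rightarrow> clause" where
  "cur b c s \<equiv> set (cand b c (mem s ''i'' 0) (mem s ''k'' 0))"

text \<open>\<open>G\<close> abstracts the guard to the reference index and the fresh answer, so
  both kinds of guard are covered at once.\<close>

lemma wp_probe:
  assumes "ready s" "mem s ''i'' 0 \<le> n" "mem s ''k'' 0 \<le> n" "v \<le> 8"
    and "\<And>m. bval g m \<longleftrightarrow> G (m ''j'' 0) (m ''z'' 0)" "bcost g \<le> 10"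
  shows "wp n orc (probe b c v g) (\<lambda>t s'. t \<le> 50 \<and> frame {''p'', ''z'', ''f''} s s' \<and>
     (\<exists>z. answers (cur b c s) (mem s ''r'' 0) (real v / 8) z \<and>
       (mem s' ''f'' 0 = 0 \<longleftrightarrow> mem s ''f'' 0 = 0 \<and> G (mem s ''j'' 0) z))) s"
  unfolding probe_def wp_Seq
  apply (rule wp_mono[OF wp_ask[OF assms(1-4)]])
  using assms(5,6) by (auto simp: store_def ready_def frame_def)

text \<open>The last two conjuncts are soundness and completeness of the flag. The time is four
  probes of at most 50 plus 6 for the increment.\<close>

lemma wp_probes:
  fixes s :: state and b c :: bool
  assumes s: "ready s" "mem s ''i'' 0 \<le> n" "mem s ''k'' 0 \<le> n"
  defines "S \<equiv> cur b c s" and "j \<equiv> mem s ''j'' 0"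
  shows "wp n orc (probes b c) (\<lambda>t s'. t \<le> 206 \<and> frame {''p'', ''z'', ''f'', ''r''} s s' \<and>
     mem s' ''r'' 0 = Suc (mem s ''r'' 0) \<and>
     (mem s' ''f'' 0 = 0 \<longrightarrow> mem s ''f'' 0 = 0 \<and> passes S j (mem s ''r'' 0)) \<and>
     (mem s ''f'' 0 = 0 \<longrightarrow> minimal S \<longrightarrow> answers S 0 (1 / 2) j \<longrightarrow> mem s' ''f'' 0 = 0)) s"
proof -
  define r where "r = mem s ''r'' 0"
  define F where "F s1 \<longleftrightarrow> frame {''p'', ''z'', ''f''} s s1" for s1
  \<comment> \<open>Restated relative to the initial state \<open>s\<close>, so that the four probes
    chain: the frame preserves the candidate, \<open>r\<close> and \<open>j\<close>.\<close>
  have probe: "wp n orc (probe b c v g) (\<lambda>t s2. t \<le> 50 \<and> F s2 \<and>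
     (\<exists>z. answers S r (real v / 8) z \<and> (mem s2 ''f'' 0 = 0 \<longleftrightarrow> mem s1 ''f'' 0 = 0 \<and> G j z))) s1"
    if s1: "F s1" and v: "v \<le> 8" and g: "\<And>m. bval g m \<longleftrightarrow> G (m ''j'' 0) (m ''z'' 0)" "bcost g \<le> 10"
    for s1 v g G
  proof -
    have eqs: "mem s1 ''i'' = mem s ''i''" "mem s1 ''k'' = mem s ''k''" "mem s1 ''r'' = mem s ''r''"
        "mem s1 ''j'' = mem s ''j''" and ready: "ready s1"
      using s1 by (simp_all add: F_def frame_def)
    have F: "F s2" if "frame {''p'', ''z'', ''f''} s1 s2" for s2
      using s1 that by (simp add: F_def frame_def)
    have "wp n orc (probe b c v g) (\<lambda>t s2. t \<le> 50 \<and> frame {''p'', ''z'', ''f''} s1 s2 \<and>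
       (\<exists>z. answers (cur b c s1) (mem s1 ''r'' 0) (real v / 8) z \<and>
         (mem s2 ''f'' 0 = 0 \<longleftrightarrow> mem s1 ''f'' 0 = 0 \<and> G (mem s1 ''j'' 0) z))) s1"
      using ready s(2,3) v g by (intro wp_probe) (simp_all only: eqs)
    then show ?thesis
      by (rule wp_mono) (use F in \<open>simp add: eqs S_def j_def r_def\<close>)
  qed
  have same: "wp n orc (probe b c v same) (\<lambda>t s2. t \<le> 50 \<and> F s2 \<and>
     (\<exists>z. answers S r (real v / 8) z \<and> (mem s2 ''f'' 0 = 0 \<longleftrightarrow> mem s1 ''f'' 0 = 0 \<and> z = j))) s1"
    if "F s1" "v \<le> 8" for s1 v
    using probe[OF that, where g = same and G = "\<lambda>j z. z = j"] by (simp add: same_def)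
  have nonzero: "wp n orc (probe b c v nonzero) (\<lambda>t s2. t \<le> 50 \<and> F s2 \<and>
     (\<exists>z. answers S r (real v / 8) z \<and> (mem s2 ''f'' 0 = 0 \<longleftrightarrow> mem s1 ''f'' 0 = 0 \<and> 0 < z))) s1"
    if "F s1" "v \<le> 8" for s1 v
    using probe[OF that, where g = nonzero and G = "\<lambda>j z. 0 < z"] by (simp add: nonzero_def)
  have "F s" using s by (simp add: F_def frame_def)
  then show ?thesis
    unfolding probes_def wp_Seq
    apply -
    apply (rule wp_mono[OF same], assumption, simp, elim conjE exE)
    apply (rule wp_mono[OF nonzero], assumption, simp, elim conjE exE)
    apply (rule wp_mono[OF same], assumption, simp, elim conjE exE)
    apply (rule wp_mono[OF nonzero], assumption, simp, elim conjE exE)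
    subgoal premises prems for t1 s1 z1 t2 s2 z2 t3 s3 z3 t4 s4 z4
    proof -
      have z: "answers S r (7/8) z1" "answers S r 1 z2" "answers S r (1/8) z3" "answers S r 0 z4"
        and f: "mem s4 ''f'' 0 = 0 \<longleftrightarrow> mem s ''f'' 0 = 0 \<and> z1 = j \<and> 0 < z2 \<and> z3 = j \<and> 0 < z4"
        using prems by auto
      \<comment> \<open>The values 7/8, 1/8 and the reference value 1/2 are all strictly inside the
        unit interval, so the indices agree; at 1 and 0 membership of \<open>S\<close>
        suffices.\<close>
      have complete: "z1 = j \<and> 0 < z2 \<and> z3 = j \<and> 0 < z4" if "minimal S" "answers S 0 (1/2) j"
        using answers_minimal_eq[OF that(1) _ _ z(1) _ _ that(2)]
          answers_minimal_eq[OF that(1) _ _ z(3) _ _ that(2)]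
          answers_member_pos z(2,4) that(1) by (auto simp: minimal_def)
      have sound: "passes S j r" if "z1 = j \<and> 0 < z2 \<and> z3 = j \<and> 0 < z4"
        using z that unfolding passes_def by auto
      have "mem s4 ''r'' = mem s ''r''" "F s4" "t1 + (t2 + (t3 + t4)) \<le> 200"
        using prems by (simp_all add: F_def frame_def)
      then show ?thesis
        using s(1) f complete sound by (simp add: incr_def store_def ready_def r_def F_def frame_def)
    qed
    done
qed

definition inv :: "clause set \<Rightarrow> state \<Rightarrow> bool" where
  "inv A s \<longleftrightarrow> ready s \<and> learned A (written s)"

lemma lit_code_lit: "lit_code (lit b i) = i + i + (if b then 2 else 1)"
  by (simp add: lit_def)

lemma learned_emit:
  assumes "learned A w" "i \<le> n" "k \<le> n" "D \<in> set \<Phi>" "D \<subseteq> set (cand b c i k)"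
  shows "learned (insert (set (cand b c i k)) A) (w @ map lit_code (cand b c i k) @ [0])"
proof -
  obtain Cs where Cs: "\<forall>C\<in>set Cs. distinct C \<and> is_clause n (set C) \<and> (\<exists>D\<in>set \<Phi>. D \<subseteq> set C)"
     "w = concat (map (\<lambda>C. map lit_code C @ [0]) Cs)"
     "\<forall>S\<in>A. minimal S \<longrightarrow> S \<in> set ` set Cs"
    using assms(1) unfolding learned_def by blast
  show ?thesis
    unfolding learned_def
    by (rule exI[of _ "Cs @ [cand b c i k]"])
      (use Cs assms distinct_cand is_clause_cand in auto)
qed

lemma learned_skip: "learned A w \<Longrightarrow> \<not> minimal S \<Longrightarrow> learned (insert S A) w"
  by (simp add: learned_def)

lemma wp_emit:
  assumes s: "inv A s" "mem s ''i'' 0 \<le> n" "mem s ''k'' 0 \<le> n"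
    and sound: "mem s ''f'' 0 = 0 \<Longrightarrow> \<exists>D\<in>set \<Phi>. D \<subseteq> cur b c s"
    and complete: "minimal (cur b c s) \<Longrightarrow> mem s ''f'' 0 = 0"
  shows "wp n orc (emit b c) (\<lambda>t s'. t \<le> 60 \<and> inv (insert (cur b c s) A) s' \<and> mem s' = mem s) s"
proof (cases "mem s ''f'' 0 = 0")
  case True
  then obtain D where "D \<in> set \<Phi>" "D \<subseteq> cur b c s" using sound by blast
  then have "learned (insert (cur b c s) A)
      (written s @ map lit_code (cand b c (mem s ''i'' 0) (mem s ''k'' 0)) @ [0])"
    using s by (intro learned_emit) (auto simp: inv_def)
  then show ?thesis
    using True s(1) by (auto simp: emit_def emit_lit_def inv_def ready_def cand_def lit_code_lit insert_commute)
next
  case False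
  then have "inv (insert (cur b c s) A) s"
    using s(1) complete learned_skip unfolding inv_def by metis
  with False show ?thesis by (simp add: emit_def)
qed

lemma wp_task:
  assumes s: "inv A s" "mem s ''i'' 0 \<le> n" "mem s ''k'' 0 \<le> n"
  shows "wp n orc (task b c) (\<lambda>t s'. t \<le> 400 * (n + 1) \<and> inv (insert (cur b c s) A) s' \<and>
     mem s' ''i'' = mem s ''i'' \<and> mem s' ''k'' = mem s ''k'') s"
proof -
  define S where "S = cur b c s"
  \<comment> \<open>After \<open>n + 1\<close> rounds a flag still at 0 gives \<open>passes\<close>
    for every \<open>r \<le> n\<close>, as soundness requires; the last conjunct carries
    completeness.\<close>
  define I where "I r s' \<longleftrightarrow> ready s' \<and> written s' = written s \<and> mem s' ''i'' = mem s ''i'' \<and>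
      mem s' ''k'' = mem s ''k'' \<and> mem s' ''r'' 0 = r \<and> answers S 0 (1 / 2) (mem s' ''j'' 0) \<and>
      (mem s' ''f'' 0 = 0 \<longrightarrow> 0 < mem s' ''j'' 0 \<and> (\<forall>r'<r. passes S (mem s' ''j'' 0) r')) \<and>
      (minimal S \<longrightarrow> mem s' ''f'' 0 = 0)" for r s'
  have loop: "wp n orc (While (up_to_n ''r'') (probes b c))
      (\<lambda>t s'. t \<le> (n + 1) * (1 + bcost (up_to_n ''r'') + 206) + (1 + bcost (up_to_n ''r'')) \<and> I (n + 1) s') s'"
    if "I 0 s'" for s'
  proof (rule wp_While_count[where I = I])
    fix x s' assume x: "x < n + 1" and I: "I x s'"
    have "cur b c s' = S" using I by (simp add: I_def S_def)
    moreover have "wp n orc (probes b c) (\<lambda>t s''. t \<le> 206 \<and> frame {''p'', ''z'', ''f'', ''r''} s' s'' \<and>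
       mem s'' ''r'' 0 = Suc (mem s' ''r'' 0) \<and>
       (mem s'' ''f'' 0 = 0 \<longrightarrow> mem s' ''f'' 0 = 0 \<and> passes (cur b c s') (mem s' ''j'' 0) (mem s' ''r'' 0)) \<and>
       (mem s' ''f'' 0 = 0 \<longrightarrow> minimal (cur b c s') \<longrightarrow> answers (cur b c s') 0 (1 / 2) (mem s' ''j'' 0) \<longrightarrow> mem s'' ''f'' 0 = 0)) s'"
      using I s by (intro wp_probes) (auto simp: I_def)
    ultimately have "wp n orc (probes b c) (\<lambda>t s'. t \<le> 206 \<and> I (Suc x) s') s'"
      by (elim wp_mono) (use I in \<open>simp add: I_def frame_def less_Suc_eq; blast\<close>)
    then show "bval (up_to_n ''r'') (mem s') \<and> wp n orc (probes b c) (\<lambda>t s'. t \<le> 206 \<and> I (Suc x) s') s'"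
      using x I by (simp add: I_def ready_def)
  qed (use that in \<open>auto simp: I_def ready_def\<close>)
  have fin: "wp n orc (emit b c) (\<lambda>t s''. t \<le> 60 \<and> inv (insert S A) s'' \<and> mem s'' = mem s') s'"
    if I: "I (n + 1) s'" for s'
  proof -
    have cur: "cur b c s' = S" using I by (simp add: I_def S_def)
    have "\<exists>D\<in>set \<Phi>. D \<subseteq> S" if "mem s' ''f'' 0 = 0"
    proof -
      have "answers S 0 (1 / 2) (mem s' ''j'' 0)" "0 < mem s' ''j'' 0"
        "\<And>r. r \<le> n \<Longrightarrow> passes S (mem s' ''j'' 0) r"
        using I that by (auto simp: I_def)
      then show ?thesis using passes_imp_subclause by metis
    qed
    then show ?thesis
      using wp_emit[of A s' b c] I s unfolding cur by (auto simp: I_def inv_def)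
  qed
  define s0 where "s0 = s\<lparr>mem := store ''r'' 0 0 (mem s)\<rparr>"
  have s0: "ready s0" "mem s0 ''i'' = mem s ''i''" "mem s0 ''k'' = mem s ''k''" "mem s0 ''r'' 0 = 0"
      "written s0 = written s"
    using s by (simp_all add: s0_def inv_def ready_def store_def)
  have "wp n orc (ask b c 4) (\<lambda>t s1. t = 25 \<and> ready s1 \<and> written s1 = written s0 \<and>
     (\<forall>x. x \<noteq> ''p'' \<longrightarrow> x \<noteq> ''z'' \<longrightarrow> mem s1 x = mem s0 x) \<and>
     answers (cur b c s0) (mem s0 ''r'' 0) (real 4 / 8) (mem s1 ''z'' 0)) s0"
    using s0 s by (intro wp_ask) simp_all
  then have ask: "wp n orc (ask b c 4) (\<lambda>t s1. t = 25 \<and> ready s1 \<and> written s1 = written s \<and>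
     mem s1 ''i'' = mem s ''i'' \<and> mem s1 ''k'' = mem s ''k'' \<and> mem s1 ''r'' 0 = 0 \<and>
     answers S 0 (1 / 2) (mem s1 ''z'' 0)) s0"
    by (rule wp_mono) (simp add: s0 S_def)
  \<comment> \<open>A minimal \<open>S\<close> never starts with a raised flag, since a clause of
    the formula makes the reference answer nonzero.\<close>
  have I0: "I 0 (s1\<lparr>mem := store ''f'' 0 y (store ''j'' 0 (mem s1 ''z'' 0) (mem s1))\<rparr>)"
    if s1: "ready s1" "written s1 = written s" "mem s1 ''i'' = mem s ''i''" "mem s1 ''k'' = mem s ''k''"
        "mem s1 ''r'' 0 = 0" "answers S 0 (1 / 2) (mem s1 ''z'' 0)"
      and y: "y = 0 \<longleftrightarrow> mem s1 ''z'' 0 \<noteq> 0" for s1 y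
    using s1 y answers_member_pos[OF _ s1(6)] by (simp add: I_def ready_def store_def minimal_def)
  \<comment> \<open>The 60 reserves time for everything before the loop: resetting \<open>r\<close>,
    the reference query, and setting \<open>j\<close> and \<open>f\<close>.\<close>
  have finish: "wp n orc (While (up_to_n ''r'') (probes b c)) (\<lambda>t. wp n orc (emit b c)
      (\<lambda>t' s'. 60 + (t + t') \<le> 400 * (n + 1) \<and> inv (insert S A) s' \<and>
        mem s' ''i'' = mem s ''i'' \<and> mem s' ''k'' = mem s ''k'')) s'" if "I 0 s'" for s'
    by (rule wp_mono[OF loop[OF that]], elim conjE, rule wp_mono[OF fin], assumption)
      (simp add: I_def)
  show ?thesis
    unfolding task_def wp_Seq wp_Store wp_Cond aval.simps s0_def[symmetric] S_def[symmetric]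
    apply (rule wp_mono[OF ask], elim conjE)
    subgoal premises prems for t s1
    proof (cases "mem s1 ''z'' 0 = 0")
      case True
      have I: "I 0 (s1\<lparr>mem := store ''f'' 0 1 (store ''j'' 0 (mem s1 ''z'' 0) (mem s1))\<rparr>)"
        by (rule I0) (use True prems in simp_all)
      show ?thesis
        apply (subst if_P)
        subgoal using True by (simp add: store_def)
        apply (rule wp_mono[OF finish])
        subgoal using I by simp
        subgoal by (erule wp_mono) (simp add: \<open>t = 25\<close>)
        done
    next
      case False
      have I: "I 0 (s1\<lparr>mem := store ''f'' 0 0 (store ''j'' 0 (mem s1 ''z'' 0) (mem s1))\<rparr>)"
        by (rule I0) (use False prems in simp_all)
      show ?thesis
        apply (subst if_not_P)
        subgoal using False by (simp add: store_def)
        apply (rule wp_mono[OF finish])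
        subgoal using I by simp
        subgoal by (erule wp_mono) (simp add: \<open>t = 25\<close>)
        done
    qed
    done
qed

section \<open>Running through all candidates, with the total time\<close>

definition cands :: "nat \<Rightarrow> nat \<Rightarrow> clause set" where
  "cands i k = (\<Union>b c. {set (cand b c i k)})"

lemma cands_eq: "cands i k = {set (cand False False i k), set (cand False True i k),
    set (cand True False i k), set (cand True True i k)}"
  by (auto simp: cands_def UNIV_bool)

lemma wp_tasks:
  assumes "inv A s" "mem s ''i'' 0 \<le> n" "mem s ''k'' 0 \<le> n"
  shows "wp n orc tasks (\<lambda>t s'. t \<le> 1700 * (n + 1) \<and>
     inv (A \<union> cands (mem s ''i'' 0) (mem s ''k'' 0)) s' \<and>
     mem s' ''i'' = mem s ''i'' \<and> mem s' ''k'' 0 = Suc (mem s ''k'' 0)) s"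
proof -
  have task: "wp n orc (task b c) (\<lambda>t s2. t \<le> 400 * (n + 1) \<and> inv (insert (cur b c s) B) s2 \<and>
      mem s2 ''i'' = mem s ''i'' \<and> mem s2 ''k'' = mem s ''k'') s1"
    if "inv B s1" "mem s1 ''i'' = mem s ''i''" "mem s1 ''k'' = mem s ''k''" for B s1 b c
    using wp_task[of B s1 b c] that assms(2,3) by simp
  have cands: "insert (cur True True s) (insert (cur True False s)
      (insert (cur False True s) (insert (cur False False s) A))) = A \<union> cands (mem s ''i'' 0) (mem s ''k'' 0)"
    unfolding cands_eq by blast
  show ?thesis
    unfolding tasks_def wp_Seq
    apply (rule wp_mono[OF task[OF assms(1) refl refl]], elim conjE)
    apply (rule wp_mono[OF task], assumption+, elim conjE)
    apply (rule wp_mono[OF task], assumption+, elim conjE)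
    apply (rule wp_mono[OF task], assumption+, elim conjE)
    unfolding cands by (simp add: incr_def store_def inv_def ready_def)
qed

lemma wp_row:
  assumes s: "inv (\<Union>i<mem s ''i'' 0. \<Union>k<n + 1. cands i k) s" "mem s ''i'' 0 \<le> n"
  shows "wp n orc row (\<lambda>t s'. t \<le> 2000 * (n + 1)\<^sup>2 \<and>
     inv (\<Union>i<mem s' ''i'' 0. \<Union>k<n + 1. cands i k) s' \<and> mem s' ''i'' 0 = Suc (mem s ''i'' 0)) s"
proof -
  define A where "A = (\<Union>i<mem s ''i'' 0. \<Union>k<n + 1. cands i k)"
  define I where "I k s' \<longleftrightarrow> inv (A \<union> (\<Union>k'<k. cands (mem s ''i'' 0) k')) s' \<and>
     mem s' ''i'' = mem s ''i'' \<and> mem s' ''k'' 0 = k" for k s'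
  have loop: "wp n orc (While (up_to_n ''k'') tasks)
      (\<lambda>t s'. t \<le> (n + 1) * (1 + bcost (up_to_n ''k'') + 1700 * (n + 1)) + (1 + bcost (up_to_n ''k'')) \<and> I (n + 1) s') s'"
    if "I 0 s'" for s'
  proof (rule wp_While_count[where I = I])
    fix k s' assume k: "k < n + 1" and I: "I k s'"
    have "wp n orc tasks (\<lambda>t s''. t \<le> 1700 * (n + 1) \<and>
       inv (A \<union> (\<Union>k'<k. cands (mem s ''i'' 0) k') \<union> cands (mem s' ''i'' 0) (mem s' ''k'' 0)) s'' \<and>
       mem s'' ''i'' = mem s' ''i'' \<and> mem s'' ''k'' 0 = Suc (mem s' ''k'' 0)) s'"
      using I k s(2) by (intro wp_tasks) (auto simp: I_def)
    moreover have "A \<union> (\<Union>k'<k. cands (mem s ''i'' 0) k') \<union> cands (mem s ''i'' 0) k =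
        A \<union> (\<Union>k'<Suc k. cands (mem s ''i'' 0) k')"
      by (auto simp: less_Suc_eq)
    ultimately show "bval (up_to_n ''k'') (mem s') \<and> wp n orc tasks (\<lambda>t s'. t \<le> 1700 * (n + 1) \<and> I (Suc k) s') s'"
      using k I by (auto simp: I_def inv_def ready_def elim!: wp_mono)
  qed (use that in \<open>auto simp: I_def ready_def inv_def\<close>)
  have A: "A \<union> (\<Union>k'<n + 1. cands (mem s ''i'' 0) k') = (\<Union>i<Suc (mem s ''i'' 0). \<Union>k<n + 1. cands i k)"
    by (simp only: A_def lessThan_Suc UN_insert Un_commute)
  \<comment> \<open>The 20 covers resetting \<open>k\<close> and incrementing
    \<open>i\<close>.\<close>
  have cost: "(n + 1) * (1 + 7 + 1700 * (n + 1)) + (1 + 7) + 20 \<le> 2000 * (n + 1)\<^sup>2"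
    by (simp add: power2_eq_square algebra_simps)
  show ?thesis
    unfolding row_def wp_Seq wp_Store
    apply (rule wp_mono[OF loop])
    subgoal using s by (simp add: I_def A_def inv_def ready_def store_def)
    subgoal using cost s unfolding I_def A
      by (simp add: incr_def store_def inv_def ready_def)
    done
qed

lemma wp_setup:
  "wp n orc (While (up_to_n ''r'') setup_cell) (\<lambda>t s. t \<le> 50 * (n + 1) \<and> inv {} s \<and> mem s ''i'' 0 = 0) (init_state n)"
proof -
  define I where "I r s \<longleftrightarrow> mem s ''n'' 0 = n \<and> (\<forall>x<r. mem s ''p'' x = 4 \<and> mem s ''q'' x = 8) \<and>
     asked s = [] \<and> written s = [] \<and> mem s ''i'' 0 = 0 \<and> mem s ''r'' 0 = r" for r and s :: state
  have "wp n orc (While (up_to_n ''r'') setup_cell)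
      (\<lambda>t s. t \<le> (n + 1) * (1 + bcost (up_to_n ''r'') + 20) + (1 + bcost (up_to_n ''r'')) \<and> I (n + 1) s) (init_state n)"
    by (rule wp_While_count[where I = I])
      (auto simp: I_def setup_cell_def incr_def store_def init_state_def less_Suc_eq)
  then show ?thesis
    by (rule wp_mono) (auto simp: I_def inv_def ready_def learned_def)
qed

text \<open>There are \<open>(n + 1)\<^sup>2\<close> index pairs with four sign patterns each, and
  every candidate takes linear time, which gives the cubic bound.\<close>

lemma wp_learner:
  "wp n orc learner (\<lambda>t s. t \<le> 3000 * (n + 1) ^ 3 \<and>
     learned (\<Union>i<n + 1. \<Union>k<n + 1. cands i k) (written s)) (init_state n)"
proof -
  define I where "I i s \<longleftrightarrow> inv (\<Union>i<mem s ''i'' 0. \<Union>k<n + 1. cands i k) s \<and> mem s ''i'' 0 = i" for i s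
  have loop: "wp n orc (While (up_to_n ''i'') row)
      (\<lambda>t s. t \<le> (n + 1) * (1 + bcost (up_to_n ''i'') + 2000 * (n + 1)\<^sup>2) + (1 + bcost (up_to_n ''i'')) \<and> I (n + 1) s) s"
    if "inv {} s" "mem s ''i'' 0 = 0" for s
  proof (rule wp_While_count[where I = I])
    fix i s assume i: "i < n + 1" and I: "I i s"
    have "wp n orc row (\<lambda>t s'. t \<le> 2000 * (n + 1)\<^sup>2 \<and>
       inv (\<Union>i<mem s' ''i'' 0. \<Union>k<n + 1. cands i k) s' \<and> mem s' ''i'' 0 = Suc (mem s ''i'' 0)) s"
      using I i by (intro wp_row) (auto simp: I_def)
    then show "bval (up_to_n ''i'') (mem s) \<and> wp n orc row (\<lambda>t s'. t \<le> 2000 * (n + 1)\<^sup>2 \<and> I (Suc i) s') s"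
      using i I by (auto simp: I_def inv_def ready_def elim!: wp_mono)
  qed (use that in \<open>auto simp: I_def ready_def inv_def\<close>)
  have "50 * N + (N * (1 + 7 + 2000 * N\<^sup>2) + (1 + 7)) \<le> 3000 * N ^ 3" if "N > 0" for N :: nat
  proof -
    have "N \<le> N ^ 3" "1 \<le> N ^ 3" using that by (simp_all add: self_le_power)
    moreover have "N * N\<^sup>2 = N ^ 3" by (simp add: power3_eq_cube power2_eq_square)
    ultimately show ?thesis by (simp add: distrib_left)
  qed
  from this[of "n + 1"] have cost: "50 * (n + 1) + ((n + 1) * (1 + 7 + 2000 * (n + 1)\<^sup>2) + (1 + 7)) \<le> 3000 * (n + 1) ^ 3"
    by simp
  have learned: "learned (\<Union>i<n + 1. \<Union>k<n + 1. cands i k) (written s)" if "I (n + 1) s" for s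
    using that unfolding I_def inv_def by metis
  show ?thesis
    unfolding learner_def wp_Seq
    apply (rule wp_mono[OF wp_setup], elim conjE, rule wp_mono[OF loop], assumption, assumption, elim conjE)
    apply (intro conjI learned)
    subgoal unfolding bcost_up_to_n by (rule order_trans[OF add_mono cost])
    subgoal by assumption
    done
qed

text \<open>Every written clause contains a clause of the formula, and every clause of the formula
  contains a minimal one, which has at most two literals and so was a candidate and was written.
  Enlarging a clause weakens it, so each formula implies the other.\<close>

lemma learned_SAT:
  assumes "learned (\<Union>i<n + 1. \<Union>k<n + 1. cands i k) w"
  obtains \<Phi>' where "encodes w \<Phi>'" "is_formula n \<Phi>'" "SAT n \<Phi>' = SAT n \<Phi>"
proof -
  obtain Cs where Cs: "\<forall>C\<in>set Cs. distinct C \<and> is_clause n (set C) \<and> (\<exists>D\<in>set \<Phi>. D \<subseteq> set C)"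
     "w = concat (map (\<lambda>C. map lit_code C @ [0]) Cs)"
     "\<forall>S\<in>(\<Union>i<n + 1. \<Union>k<n + 1. cands i k). minimal S \<longrightarrow> S \<in> set ` set Cs"
    using assms[unfolded learned_def] by (elim exE conjE) (rule that)
  have sub: "\<exists>C\<in>set Cs. set C \<subseteq> D" if D: "D \<in> set \<Phi>" for D
  proof -
    obtain S where S: "minimal S" "S \<subseteq> D" using obtain_minimal[OF D] .
    then have "S \<in> set \<Phi>" by (simp add: minimal_def)
    then obtain b c i k where "i \<le> n" "k \<le> n" "S = set (cand b c i k)"
      using clause_eq_cand[OF clause card_clause] by metis
    then have "S \<in> (\<Union>i<n + 1. \<Union>k<n + 1. cands i k)"
      by (intro UN_I[of i] UN_I[of k]) (auto simp: cands_def)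
    then have "S \<in> set ` set Cs" by (rule bspec[OF Cs(3), rule_format, OF _ S(1)])
    then show ?thesis using S(2) by blast
  qed
  have "encodes w (map set Cs)" unfolding encodes_def using Cs by blast
  moreover have "is_formula n (map set Cs)" using Cs(1) by (simp add: is_formula_def)
  moreover have "SAT n (map set Cs) = SAT n \<Phi>"
  proof -
    have "(\<forall>C\<in>set (map set Cs). \<exists>l\<in>C. lit_true x l) \<longleftrightarrow> (\<forall>C\<in>set \<Phi>. \<exists>l\<in>C. lit_true x l)" for x
    proof (intro iffI ballI)
      fix D assume sat: "\<forall>C\<in>set (map set Cs). \<exists>l\<in>C. lit_true x l" and "D \<in> set \<Phi>"
      then obtain C where "C \<in> set Cs" "set C \<subseteq> D" using sub by metis
      with sat show "\<exists>l\<in>D. lit_true x l" by auto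
    next
      fix C assume sat: "\<forall>D\<in>set \<Phi>. \<exists>l\<in>D. lit_true x l" and "C \<in> set (map set Cs)"
      then obtain D where "D \<in> set \<Phi>" "D \<subseteq> C" using Cs(1) by auto
      with sat show "\<exists>l\<in>C. lit_true x l" by blast
    qed
    then show ?thesis by (simp only: SAT_def)
  qed
  ultimately show thesis by (rule that)
qed

end

theorem theorem3:
  "\<exists>(prog :: com) (p :: nat poly). \<forall>(n :: nat) (\<Phi> :: formula) (orc :: clause_oracle).
     is_2sat n \<Phi> \<and> repetition_free \<Phi> \<and> worst_violated_oracle n \<Phi> orc \<longrightarrow>
     (\<exists>t s \<Phi>'. exec n orc prog (init_state n) t s \<and> t \<le> poly p n \<and>
        encodes (written s) \<Phi>' \<and> is_formula n \<Phi>' \<and> SAT n \<Phi>' = SAT n \<Phi>)"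
proof (rule exI[of _ learner], rule exI[of _ "smult 3000 ([:1, 1:] ^ 3)"], intro allI impI)
  fix n \<Phi> orc
  assume "is_2sat n \<Phi> \<and> repetition_free \<Phi> \<and> worst_violated_oracle n \<Phi> orc"
  then interpret hidden_2sat n \<Phi> orc by unfold_locales auto
  from wp_learner obtain t s where "exec n orc learner (init_state n) t s" "t \<le> 3000 * (n + 1) ^ 3"
      "learned (\<Union>i<n + 1. \<Union>k<n + 1. cands i k) (written s)"
    unfolding wp_def by (elim exE conjE)
  moreover from this(3) obtain \<Phi>' where "encodes (written s) \<Phi>'" "is_formula n \<Phi>'" "SAT n \<Phi>' = SAT n \<Phi>"
    by (rule learned_SAT)
  \<comment> \<open>The witness polynomial is 3000 times the cube of \<open>X + 1\<close>.\<close>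
  moreover have "poly (smult 3000 ([:1, 1:] ^ 3)) n = 3000 * (n + 1) ^ 3" by (simp add: poly_power)
  ultimately show "\<exists>t s \<Phi>'. exec n orc learner (init_state n) t s \<and> t \<le> poly (smult 3000 ([:1, 1:] ^ 3)) n \<and>
        encodes (written s) \<Phi>' \<and> is_formula n \<Phi>' \<and> SAT n \<Phi>' = SAT n \<Phi>"
    by metis
qed

end
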